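(* Let $K$ be a field and let $a,d\in\mathbb{N}^2$ be linearly independent over $\mathbb{Q}$ such that $\{a,a+d,a+2d,a+3d\}$ is a minimal generating set of $S_{a,d,3}=\langle a,a+d,a+2d,a+3d\rangle$. Then the Hilbert series of $K[S_{a,d,3}]$ is $$H(K[S_{a,d,3}];\mathbf{t})=\frac{1-\sum_{i=2}^{4}\mathbf{t}^{2a+id}+\sum_{i=4}^{5}\mathbf{t}^{3a+id}}{\prod_{i=0}^{3}(1-\mathbf{t}^{a+id})}.$$
   Context: $\mathbb{N}$ denotes the set of non-negative integers. $\langle a_1,\ldots,a_n\rangle=\{\sum_i\lambda_i a_i\mid \lambda_i\in\mathbb{N}\}$ is the affine semigroup generated by $a_1,\ldots,a_n\in\mathbb{N}^r$. $K[S]=\bigoplus_{s\in S}K\mathbf{t}^s\subseteq K[t_1,\ldots,t_r]$ is the semigroup ring of $S$, where $\mathbf{t}^s=t_1^{s_1}\cdots t_r^{s_r}$. The Hilbert series of $K[S]$ is the formal sum $H(K[S];\mathbf{t})=\sum_{s\in S}\mathbf{t}^s$. *)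

theory Defs
  imports
    "HOL-Analysis.Analysis"
    "HOL-Library.Poly_Mapping"
    "HOL-Computational_Algebra.Formal_Power_Series"
begin

definition rat_vec :: "nat ^ 'r \<Rightarrow> rat ^ 'r::finite" where
  "rat_vec v = (\<chi> i. of_nat (v $ i))"

text \<open>
  Linear independence of the pair \<open>a, d\<close> as a family: \<^const>\<open>vec.independent\<close> speaks about
  a set, so the case \<open>a = d\<close> has to be excluded separately.
\<close>

definition lin_independent_over_rat :: "nat ^ 'r \<Rightarrow> nat ^ 'r::finite \<Rightarrow> bool" where
  "lin_independent_over_rat a d \<longleftrightarrow> a \<noteq> d \<and> vec.independent {rat_vec a, rat_vec d}"

text \<open>Meant for finite \<open>A\<close> only.\<close>

definition affine_semigroup :: "(nat ^ 'r::finite) set \<Rightarrow> (nat ^ 'r) set" where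
  "affine_semigroup A = {\<Sum>x\<in>A. l x *s x | l :: nat ^ 'r \<Rightarrow> nat. True}"

definition minimal_generating_set :: "(nat ^ 'r::finite) set \<Rightarrow> (nat ^ 'r) set \<Rightarrow> bool" where
  "minimal_generating_set A S \<longleftrightarrow>
     finite A \<and> affine_semigroup A = S \<and> (\<forall>B. B \<subset> A \<longrightarrow> affine_semigroup B \<noteq> S)"

text \<open>
  The polynomial ring \<open>K[t\<^sub>1,\<dots>,t\<^sub>r]\<close> is the type of finitely supported maps from exponent vectors
  to \<open>K\<close> with the convolution product; \<open>Poly_Mapping.single s c\<close> is the term \<open>c t\<^sup>s\<close>. The direct
  sum of the \<open>K t\<^sup>s\<close> for \<open>s \<in> S\<close> consists of the polynomials all of whose exponents lie in \<open>S\<close>.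
\<close>

definition semigroup_ring :: "(nat ^ 'r::finite) set \<Rightarrow> (nat ^ 'r \<Rightarrow>\<^sub>0 'k::field) set" where
  "semigroup_ring S = {p. Poly_Mapping.keys p \<subseteq> S}"

text \<open>
  Power series in \<open>t\<^sub>1, t\<^sub>2\<close> are series in \<open>t\<^sub>2\<close> over the series in \<open>t\<^sub>1\<close>: the coefficient of
  \<open>t\<^sub>1\<^sup>m t\<^sub>2\<^sup>n\<close> in \<open>F\<close> is \<open>fps_nth (fps_nth F n) m\<close>. Rational rather than integer coefficients make the
  library's division of power series available.
\<close>

type_synonym series2 = "rat fps fps"

definition tpow :: "nat ^ 2 \<Rightarrow> series2" where
  "tpow s = fps_const (fps_X ^ (s $ 1)) * fps_X ^ (s $ 2)"

text \<open>The formal sum of \<open>t\<^sup>s\<close> over all \<open>s \<in> A\<close>, where \<open>A\<close> may be infinite.\<close>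

definition formal_sum :: "(nat ^ 2) set \<Rightarrow> series2" where
  "formal_sum A = Abs_fps (\<lambda>n. Abs_fps (\<lambda>m. if vector [m, n] \<in> A then 1 else 0))"

text \<open>
  The argument is meant to be a semigroup ring \<open>K[S]\<close>. Its monomials \<open>t\<^sup>s\<close> are those with
  \<open>s \<in> S\<close>, so that the value is the formal sum of \<open>t\<^sup>s\<close> over \<open>s \<in> S\<close>; this is
  \<open>hilbert_series_semigroup_ring\<close> below.
\<close>

definition hilbert_series :: "(nat ^ 2 \<Rightarrow>\<^sub>0 'k::field) set \<Rightarrow> series2" where
  "hilbert_series R = formal_sum {s. Poly_Mapping.single s 1 \<in> R}"

lemma hilbert_series_semigroup_ring:
  "hilbert_series (semigroup_ring S :: (nat ^ 2 \<Rightarrow>\<^sub>0 'k::field) set) = formal_sum S"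
  by (simp add: hilbert_series_def semigroup_ring_def)

lemma tpow_nth: "fps_nth (fps_nth (tpow s) n) m = (if s = vector [m, n] then 1 else 0)"
  by (auto simp: tpow_def vec_eq_iff forall_2 fps_X_power_iff)

lemma formal_sum_finite: "finite A \<Longrightarrow> formal_sum A = (\<Sum>s\<in>A. tpow s)"
  by (rule fps_ext, rule fps_ext) (simp add: formal_sum_def fps_sum_nth tpow_nth)

text \<open>
  Division in the type \<^typ>\<open>series2\<close> is a total operation; it has its usual meaning for every
  divisor with nonzero constant term, in particular for a product of factors \<open>1 - t\<^sup>v\<close> with
  \<open>v \<noteq> 0\<close>.
\<close>

lemma series2_divide_eq_iff:
  fixes f g h :: series2
  assumes "fps_nth (fps_nth g 0) 0 \<noteq> 0"
  shows "f / g = h \<longleftrightarrow> f = h * g"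
proof -
  have g0: "fps_nth g 0 \<noteq> 0" using assms by auto
  have inv: "fps_nth g 0 * inverse (fps_nth g 0) = 1" using assms by (rule inverse_mult_eq_1')
  have r: "g * inverse g = 1"
    using fps_right_inverse[OF inv] by (simp only: fps_inverse_def[of g])
  have div: "f / g = f * inverse g"
    using g0 by (simp add: fps_divide_def)
  show ?thesis
  proof
    assume "f / g = h"
    then have "h * g = f * (g * inverse g)" unfolding div by (auto simp only: ac_simps)
    then show "f = h * g" using r by simp
  next
    assume "f = h * g"
    then have "f / g = h * (g * inverse g)" unfolding div by (simp only: ac_simps)
    then show "f / g = h" using r by simp
  qed
qed

end

theory Submission
  imports Defs
begin

text \<open>
  Because \<open>a\<close> and \<open>d\<close> are linearly independent, \<open>(n, k) \<mapsto> n a + k d\<close> is injective, and it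
  identifies the semigroup with the lattice points \<open>{(n, k). k \<le> 3 n}\<close> of a plane cone, the
  cone over the twisted cubic. The extremal generators \<open>a\<close> and \<open>a + 3 d\<close> form a regular sequence in
  the semigroup ring: multiplying the Hilbert series by \<open>1 - t\<^sup>v\<close> amounts to removing the translate
  by \<open>v\<close> from the set of exponents (\<open>formal_sum_diff_translate\<close>), and doing this for \<open>v = a\<close> and then
  for \<open>v = a + 3 d\<close> leaves just the three exponents \<open>0\<close>, \<open>a + d\<close>, \<open>a + 2 d\<close>. Hence, writing
  \<open>A = t\<^sup>a\<close> and \<open>D = t\<^sup>d\<close>,
  \<open>H (1 - A) (1 - A D\<^sup>3) = 1 + A D + A D\<^sup>2\<close>,
  and multiplying both sides by the remaining factors \<open>(1 - A D)(1 - A D\<^sup>2)\<close> turns the right-hand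
  side into \<open>1 - A\<^sup>2 (D\<^sup>2 + D\<^sup>3 + D\<^sup>4) + A\<^sup>3 (D\<^sup>4 + D\<^sup>5)\<close>.
\<close>

lemma tpow_0: "tpow 0 = 1"
  by (simp add: tpow_def)

lemma tpow_add: "tpow (u + v) = tpow u * tpow v"
  by (simp add: tpow_def power_add fps_const_mult[symmetric] mult_ac del: fps_const_mult)

lemma tpow_scale: "tpow (n *s v) = tpow v ^ n"
  by (simp add: tpow_def power_mult_distrib fps_const_power power_mult[symmetric] mult.commute)

lemma tpow_mult_formal_sum: "tpow v * formal_sum A = formal_sum ((+) v ` A)"
proof (rule fps_ext, rule fps_ext)
  fix n m
  have "vector [m, n] \<in> (+) v ` A \<longleftrightarrow>
      v $ 1 \<le> m \<and> v $ 2 \<le> n \<and> vector [m - v $ 1, n - v $ 2] \<in> A" (is "?L \<longleftrightarrow> ?R")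
  proof
    assume ?L
    then obtain w where w: "w \<in> A" "vector [m, n] = v + w" by blast
    from w(2) have mn: "m = v $ 1 + w $ 1" "n = v $ 2 + w $ 2"
      by (auto simp: vec_eq_iff forall_2)
    have "vector [m - v $ 1, n - v $ 2] = w"
      by (simp add: vec_eq_iff forall_2 mn)
    with w(1) mn show ?R by simp
  next
    assume R: ?R
    then have "vector [m, n] = v + vector [m - v $ 1, n - v $ 2]"
      by (simp add: vec_eq_iff forall_2)
    with R show ?L by blast
  qed
  then show "fps_nth (fps_nth (tpow v * formal_sum A) n) m =
      fps_nth (fps_nth (formal_sum ((+) v ` A)) n) m"
    by (simp add: tpow_def formal_sum_def mult.assoc fps_X_power_mult_nth)
qed

lemma formal_sum_diff: "B \<subseteq> A \<Longrightarrow> formal_sum (A - B) = formal_sum A - formal_sum B"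
  by (rule fps_ext, rule fps_ext) (auto simp: formal_sum_def)

text \<open>
  The combinatorial form of dividing out the nonzerodivisor \<open>t\<^sup>v\<close>: the exponents that survive
  in the quotient are those outside the translate of \<open>A\<close> by \<open>v\<close>.
\<close>

lemma formal_sum_diff_translate:
  assumes "(+) v ` A \<subseteq> A"
  shows "(1 - tpow v) * formal_sum A = formal_sum (A - (+) v ` A)"
  by (simp add: formal_sum_diff[OF assms] tpow_mult_formal_sum[symmetric] left_diff_distrib)

lemma inj_lattice_map:
  fixes a d :: "nat ^ 'r::finite"
  assumes "lin_independent_over_rat a d"
  shows "inj (\<lambda>(n, k). n *s a + k *s d)"
proof (rule injI, clarify)
  fix n k n' k' :: nat
  assume eq: "n *s a + k *s d = n' *s a + k' *s d"
  define x y where "x = rat_vec a" and "y = rat_vec d"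
  have xy: "x \<noteq> y" "vec.independent {x, y}"
    using assms by (auto simp: lin_independent_over_rat_def rat_vec_def x_def y_def vec_eq_iff)
  define u where "u v = (if v = x then of_nat n - of_nat n' else of_nat k - of_nat k' :: rat)" for v
  have "(\<Sum>v\<in>{x, y}. u v *s v) = (of_nat n - of_nat n') *s x + (of_nat k - of_nat k') *s y"
    using xy(1) by (auto simp: u_def)
  also have "\<dots> = 0"
  proof -
    have "of_nat n * of_nat (a $ i) + of_nat k * of_nat (d $ i) =
        (of_nat n' * of_nat (a $ i) + of_nat k' * of_nat (d $ i) :: rat)" for i
    proof -
      have "n * a $ i + k * d $ i = n' * a $ i + k' * d $ i"
        using arg_cong[OF eq, of "\<lambda>v. v $ i"] by simp
      then show ?thesis by (metis of_nat_add of_nat_mult)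
    qed
    then show ?thesis
      by (simp add: vec_eq_iff x_def y_def rat_vec_def algebra_simps)
  qed
  finally have "u x = 0" "u y = 0"
    using vec.independentD[OF xy(2), of "{x, y}" u] by auto
  then show "n = n' \<and> k = k'"
    using xy(1) by (auto simp: u_def)
qed

text \<open>
  A point \<open>n a + k d\<close> with \<open>k = 3 q + r\<close>, \<open>r < 3\<close>, is reached by \<open>q\<close> copies of \<open>a + 3 d\<close>, one copy
  of \<open>a + r d\<close> if \<open>r \<noteq> 0\<close>, and copies of \<open>a\<close>; the condition \<open>k \<le> 3 n\<close> says that
  \<open>n\<close> summands suffice.
\<close>

lemma affine_semigroup_eq_cone:
  fixes a d :: "nat ^ 'r::finite"
  assumes "d \<noteq> 0"
  shows "affine_semigroup {a, a + d, a + 2 *s d, a + 3 *s d} =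
    (\<lambda>(n, k). n *s a + k *s d) ` {(n, k). k \<le> 3 * n}"
    (is "affine_semigroup ?G = ?C")
proof -
  obtain j where "d $ j \<noteq> 0" using assms by (auto simp: vec_eq_iff)
  then have "a $ j \<noteq> (a + d) $ j" "a $ j \<noteq> (a + 2 *s d) $ j" "a $ j \<noteq> (a + 3 *s d) $ j"
    "(a + d) $ j \<noteq> (a + 2 *s d) $ j" "(a + d) $ j \<noteq> (a + 3 *s d) $ j"
    "(a + 2 *s d) $ j \<noteq> (a + 3 *s d) $ j"
    by simp_all
  then have ne: "a \<noteq> a + d" "a \<noteq> a + 2 *s d" "a \<noteq> a + 3 *s d"
    "a + d \<noteq> a + 2 *s d" "a + d \<noteq> a + 3 *s d" "a + 2 *s d \<noteq> a + 3 *s d"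
    by metis+
  have sum: "(\<Sum>x\<in>?G. l x *s x) =
      (l a + l (a + d) + l (a + 2 *s d) + l (a + 3 *s d)) *s a +
      (l (a + d) + 2 * l (a + 2 *s d) + 3 * l (a + 3 *s d)) *s d" for l
  proof -
    have "(\<Sum>x\<in>?G. l x *s x) = l a *s a + (l (a + d) *s (a + d) +
        (l (a + 2 *s d) *s (a + 2 *s d) + l (a + 3 *s d) *s (a + 3 *s d)))"
      using ne by simp
    then show ?thesis by (simp add: vec_eq_iff algebra_simps)
  qed
  show ?thesis
  proof (intro equalityI subsetI)
    fix s assume "s \<in> affine_semigroup ?G"
    then obtain l where "s = (\<Sum>x\<in>?G. l x *s x)"
      unfolding affine_semigroup_def by blast
    then show "s \<in> ?C" unfolding sum
      by (intro image_eqI[where x = "(l a + l (a + d) + l (a + 2 *s d) + l (a + 3 *s d),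
          l (a + d) + 2 * l (a + 2 *s d) + 3 * l (a + 3 *s d))"]) auto
  next
    fix s assume "s \<in> ?C"
    then obtain n k where s: "s = n *s a + k *s d" and k: "k \<le> 3 * n" by auto
    define q r where "q = k div 3" and "r = k mod 3"
    have qr: "k = 3 * q + r" "r < 3" by (auto simp: q_def r_def)
    define l where "l x = (if x = a + 3 *s d then q
      else if x = a + d then (if r = 1 then 1 else 0)
      else if x = a + 2 *s d then (if r = 2 then 1 else 0)
      else n - q - (if r = 0 then 0 else 1))" for x
    have l: "l a = n - q - (if r = 0 then 0 else 1)" "l (a + d) = (if r = 1 then 1 else 0)"
      "l (a + 2 *s d) = (if r = 2 then 1 else 0)" "l (a + 3 *s d) = q"
      unfolding l_def using ne ne[symmetric] by simp_all
    have "l a + l (a + d) + l (a + 2 *s d) + l (a + 3 *s d) = n"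
      "l (a + d) + 2 * l (a + 2 *s d) + 3 * l (a + 3 *s d) = k"
      unfolding l using k qr by (auto split: if_splits)
    then have "s = (\<Sum>x\<in>?G. l x *s x)" unfolding sum s by simp
    then show "s \<in> affine_semigroup ?G" unfolding affine_semigroup_def by blast
  qed
qed

text \<open>
  Working in the coordinates \<open>(n, k)\<close>, the first removal leaves the origin together with the points
  \<open>k \<in> {3 n - 2, 3 n - 1, 3 n}\<close> of each level \<open>n \<ge> 1\<close>, a set which is again stable under
  translation by \<open>(1, 3)\<close>.
\<close>

lemma cone_formal_sum:
  assumes "inj (\<lambda>(n, k). n *s a + k *s d)"
  shows "(1 - tpow (a + 3 *s d)) * ((1 - tpow a) *
      formal_sum ((\<lambda>(n, k). n *s a + k *s d) ` {(n, k). k \<le> 3 * n})) =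
    1 + tpow (a + d) + tpow (a + 2 *s d)"
proof -
  define \<phi> where "\<phi> = (\<lambda>(n, k). n *s a + k *s d)"
  have inj: "inj \<phi>" using assms by (simp add: \<phi>_def)
  have shift: "(+) (\<phi> (i, j)) ` \<phi> ` X = \<phi> ` (\<lambda>(n, k). (i + n, j + k)) ` X" for i j X
    by (simp add: image_image \<phi>_def case_prod_beta vec_eq_iff algebra_simps)
  have step: "(1 - tpow (\<phi> (i, j))) * formal_sum (\<phi> ` X) =
      formal_sum (\<phi> ` (X - (\<lambda>(n, k). (i + n, j + k)) ` X))"
    if "(\<lambda>(n, k). (i + n, j + k)) ` X \<subseteq> X" for i j X
    using that formal_sum_diff_translate[of "\<phi> (i, j)" "\<phi> ` X"]
    by (simp add: shift image_mono image_set_diff[OF inj])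
  define C where "C = {(n::nat, k::nat). k \<le> 3 * n}"
  define T where "T = {(n::nat, k::nat). k \<le> 3 * n \<and> 3 * n < k + 3}"
  have translate: "(\<lambda>(n, k). (i + n, j + k)) ` X =
      {(n, k). i \<le> n \<and> j \<le> k \<and> (n - i, k - j) \<in> X}" for i j :: nat and X
    by (force simp: image_iff)
  have C: "(1 - tpow (\<phi> (1, 0))) * formal_sum (\<phi> ` C) = formal_sum (\<phi> ` T)"
  proof -
    have "C - (\<lambda>(n, k). (1 + n, 0 + k)) ` C = T"
      unfolding translate by (auto simp: C_def T_def)
    moreover have "(\<lambda>(n, k). (1 + n, 0 + k)) ` C \<subseteq> C"
      by (auto simp: C_def)
    ultimately show ?thesis using step[of 1 0 C] by (simp only:)
  qed
  have T: "(1 - tpow (\<phi> (1, 3))) * formal_sum (\<phi> ` T) =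
      formal_sum (\<phi> ` {(0, 0), (1, 1), (1, 2)})"
  proof -
    have "T - (\<lambda>(n, k). (1 + n, 3 + k)) ` T = {(0, 0), (1, 1), (1, 2)}"
      unfolding translate by (auto simp: T_def)
    moreover have "(\<lambda>(n, k). (1 + n, 3 + k)) ` T \<subseteq> T"
      by (auto simp: T_def)
    ultimately show ?thesis using step[of 1 3 T] by (simp only:)
  qed
  have "formal_sum (\<phi> ` {(0, 0), (1, 1), (1, 2)}) = (\<Sum>p\<in>{(0, 0), (1, 1), (1, 2)}. tpow (\<phi> p))"
    using sum.reindex[OF inj_on_subset[OF inj subset_UNIV], of tpow "{(0, 0), (1, 1), (1, 2)}"]
    by (simp only: formal_sum_finite finite.intros finite_imageI comp_def)
  also have "\<dots> = 1 + tpow (a + d) + tpow (a + 2 *s d)"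
    by (simp add: \<phi>_def tpow_0 tpow_add tpow_scale)
  finally have rest: "formal_sum (\<phi> ` {(0, 0), (1, 1), (1, 2)}) = 1 + tpow (a + d) + tpow (a + 2 *s d)" .
  have "\<phi> (1, 0) = a" "\<phi> (1, 3) = a + 3 *s d"
    by (simp_all add: \<phi>_def vec_eq_iff)
  then have "(1 - tpow (a + 3 *s d)) * ((1 - tpow a) * formal_sum (\<phi> ` C)) =
      1 + tpow (a + d) + tpow (a + 2 *s d)"
    using C T rest by (simp only:)
  then show ?thesis by (simp only: \<phi>_def C_def)
qed

theorem proposition5p3:
  fixes a d :: "nat ^ 2" and S :: "(nat ^ 2) set"
  defines "S \<equiv> affine_semigroup {a, a + d, a + 2 *s d, a + 3 *s d}"
  assumes "lin_independent_over_rat a d"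
    and "minimal_generating_set {a, a + d, a + 2 *s d, a + 3 *s d} S"
  shows "hilbert_series (semigroup_ring S :: (nat ^ 2 \<Rightarrow>\<^sub>0 'k::field) set) =
    (1 - (\<Sum>i = 2..4. tpow (2 *s a + i *s d)) + (\<Sum>i = 4..5. tpow (3 *s a + i *s d)))
      / (\<Prod>i = 0..3. 1 - tpow (a + i *s d))"
proof -
  have inj: "inj (\<lambda>(n, k). n *s a + k *s d)"
    using assms(2) by (rule inj_lattice_map)
  have a0: "a \<noteq> 0" and d0: "d \<noteq> 0"
    using injD[OF inj, of "(1, 0)" "(0, 0)"] injD[OF inj, of "(0, 1)" "(0, 0)"] by auto
  define H where "H = formal_sum S"
  define A D where "A = tpow a" and "D = tpow d"
  have H: "(1 - A * D ^ 3) * ((1 - A) * H) = 1 + A * D + A * D ^ 2"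
    using cone_formal_sum[OF inj]
    by (simp add: H_def S_def affine_semigroup_eq_cone[OF d0] A_def D_def tpow_add tpow_scale)
  have num: "1 - (\<Sum>i = 2..4. tpow (2 *s a + i *s d)) + (\<Sum>i = 4..5. tpow (3 *s a + i *s d)) =
      1 - A ^ 2 * (D ^ 2 + D ^ 3 + D ^ 4) + A ^ 3 * (D ^ 4 + D ^ 5)"
    by (simp add: numeral_eq_Suc tpow_add tpow_scale A_def D_def algebra_simps)
  have den: "(\<Prod>i = 0..3. 1 - tpow (a + i *s d)) =
      (1 - A) * (1 - A * D) * (1 - A * D ^ 2) * (1 - A * D ^ 3)"
    by (simp add: numeral_eq_Suc tpow_add tpow_scale A_def D_def)
  have "H * ((1 - A) * (1 - A * D) * (1 - A * D ^ 2) * (1 - A * D ^ 3)) =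
      (1 + A * D + A * D ^ 2) * (1 - A * D) * (1 - A * D ^ 2)"
    unfolding H[symmetric] by (simp only: ac_simps)
  also have "\<dots> = 1 - A ^ 2 * (D ^ 2 + D ^ 3 + D ^ 4) + A ^ 3 * (D ^ 4 + D ^ 5)"
    by algebra
  finally have prod: "1 - A ^ 2 * (D ^ 2 + D ^ 3 + D ^ 4) + A ^ 3 * (D ^ 4 + D ^ 5) =
      H * ((1 - A) * (1 - A * D) * (1 - A * D ^ 2) * (1 - A * D ^ 3))" ..
  \<comment> \<open>Division of series has its usual meaning here because the denominator has constant term \<open>1\<close>.\<close>
  have "fps_nth (fps_nth (1 - tpow (a + i *s d)) 0) 0 = 1" for i
  proof -
    have "a + i *s d \<noteq> vector [0, 0]"
      using a0 by (auto simp: vec_eq_iff forall_2)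
    then show ?thesis by (simp add: tpow_nth)
  qed
  from this[of 0] this have "fps_nth (fps_nth (\<Prod>i = 0..3. 1 - tpow (a + i *s d)) 0) 0 = 1"
    by (simp add: numeral_eq_Suc)
  then have "fps_nth (fps_nth (\<Prod>i = 0..3. 1 - tpow (a + i *s d)) 0) 0 \<noteq> 0" by simp
  then show ?thesis
    unfolding hilbert_series_semigroup_ring H_def[symmetric]
    by (rule series2_divide_eq_iff[THEN iffD2, symmetric]) (simp only: num den prod)
qed

end
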